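(* Let $G\le S_n$ and let $f$ denote the number of orbits of $G$ acting on $[n]$. Then $\mathrm{SS}_G$ is a polyhedron with at most $n-f$ facets.
   Context: Define the chain of pointwise stabilizers $G^0:=G$ and $G^i:=\{g\in G^{i-1}: g(i)=i\}$ for $i\in[n]$, and let $\mathrm{Orb}_{G^{i-1}}(i)=\{g(i):g\in G^{i-1}\}$. The Schreier–Sims polyhedron is $\mathrm{SS}_G:=\{x\in\mathbb{R}^n: x_i\ge x_j \text{ for all } i\in[n],\ j\in\mathrm{Orb}_{G^{i-1}}(i)\}$. *)

theory Defs
  imports
    "HOL-Analysis.Analysis"
    "HOL-Algebra.Group_Action"
    "HOL-Algebra.Sym_Groups"
begin

primrec stab_chain :: "(nat \<Rightarrow> nat) set \<Rightarrow> nat \<Rightarrow> (nat \<Rightarrow> nat) set" where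
  "stab_chain G 0 = G"
| "stab_chain G (Suc i) = {g \<in> stab_chain G i. g (Suc i) = Suc i}"

definition basic_orbit :: "(nat \<Rightarrow> nat) set \<Rightarrow> nat \<Rightarrow> nat set" where
  "basic_orbit G i = {g i | g. g \<in> stab_chain G (i - 1)}"

text \<open>
  Permutations act on \<open>{1..n}\<close>, while the coordinates of \<^typ>\<open>real ^ 'n\<close> are indexed by
  the type \<open>'n\<close>. The function \<open>lab\<close> is meant to be a bijection from \<open>{1..n}\<close> onto \<open>'n\<close>;
  the coordinate \<open>x\<^sub>i\<close> is \<open>x $ lab i\<close>.
\<close>

definition schreier_sims :: "nat \<Rightarrow> (nat \<Rightarrow> 'n) \<Rightarrow> (nat \<Rightarrow> nat) set \<Rightarrow> (real ^ 'n) set" where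
  "schreier_sims n lab G =
     {x. \<forall>i\<in>{1..n}. \<forall>j\<in>basic_orbit G i. x $ lab i \<ge> x $ lab j}"

end

theory Submission
  imports Defs
begin

text \<open>
  Call \<open>i < j\<close> a parent of \<open>j\<close> if \<open>j\<close> lies in the basic orbit of \<open>i\<close>. If \<open>i < k\<close> are both parents
  of \<open>j\<close>, then \<open>i\<close> is a parent of \<open>k\<close>, because the stabilizer used for \<open>k\<close> is contained in the one
  used for \<open>i\<close>. So all inequalities follow by transitivity from those between each \<open>j\<close> and
  its largest parent, which leaves one inequality per point that has a parent. Descending along
  parents stays within a \<open>G\<close>-orbit, so every orbit contains a parentless point, and at most
  \<open>n - f\<close> inequalities remain. A polyhedron cut out by \<open>m\<close> halfspaces has at most \<open>m\<close> facets.
\<close>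

text \<open>The facets of an irredundant system correspond to its inequalities turned into
  equations. A minimal subfamily of \<open>H\<close> that still describes the polyhedron is
  irredundant, so it supplies all facets.\<close>

lemma card_facets_Inter_halfspaces_le:
  fixes H :: "'a::euclidean_space set set"
  assumes "finite H"
    and halfspace: "\<And>h. h \<in> H \<Longrightarrow> \<exists>a b. a \<noteq> 0 \<and> h = {x. a \<bullet> x \<le> b}"
  shows "finite {F. F facet_of \<Inter>H}" "card {F. F facet_of \<Inter>H} \<le> card H"
proof -
  define S where "S = \<Inter>H"
  \<comment> \<open>The polyhedron need not be full-dimensional, so redundancy is measured inside
    \<open>affine hull S\<close>, as \<open>facet_of_polyhedron_explicit\<close> demands.\<close>
  define K where "K = {F. F \<subseteq> H \<and> affine hull S \<inter> \<Inter>F = S}"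
  have "S \<subseteq> affine hull S"
    by (rule hull_subset)
  then have "H \<in> K" and "finite K"
    using \<open>finite H\<close> by (auto simp: K_def S_def)
  then obtain M where "M \<in> K" and min: "\<And>F. F \<in> K \<Longrightarrow> F \<subseteq> M \<Longrightarrow> M = F"
    using finite_has_minimal2[of K H] by blast
  then have M: "M \<subseteq> H" "finite M" "affine hull S \<inter> \<Inter>M = S"
    using \<open>finite H\<close> finite_subset by (auto simp: K_def)
  have "\<forall>h\<in>M. \<exists>a b. a \<noteq> 0 \<and> h = {x. a \<bullet> x \<le> b}"
    using halfspace M(1) by blast
  then obtain a b where ab: "\<And>h. h \<in> M \<Longrightarrow> a h \<noteq> 0 \<and> h = {x. a h \<bullet> x \<le> b h}"
    by metis
  \<comment> \<open>Irredundancy is minimality of \<open>M\<close>: no proper subfamily lies in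
    \<open>K\<close>.\<close>
  have strict: "S \<subset> affine hull S \<inter> \<Inter>F" if "F \<subset> M" for F
  proof -
    have "S \<subseteq> affine hull S \<inter> \<Inter>F"
      using M(3) that by blast
    moreover have "F \<notin> K"
      using min that by blast
    ultimately show ?thesis
      using that M(1) by (auto simp: K_def)
  qed
  have "{F. F facet_of S} = (\<lambda>h. S \<inter> {x. a h \<bullet> x = b h}) ` M"
    using facet_of_polyhedron_explicit[OF M(2) M(3)[symmetric] ab strict] by blast
  then show "finite {F. F facet_of \<Inter>H}" "card {F. F facet_of \<Inter>H} \<le> card H"
    using M(2) order_trans[OF card_image_le[OF M(2)] card_mono[OF \<open>finite H\<close> M(1)]]
    by (simp_all add: S_def)
qed

lemma mem_stab_chain_iff: "g \<in> stab_chain G i \<longleftrightarrow> g \<in> G \<and> (\<forall>k\<in>{1..i}. g k = k)"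
  by (induction i) (auto simp: le_Suc_eq)

lemma sym_subgroup_permutes:
  assumes "subgroup G (sym_group n)" "g \<in> G"
  shows "g permutes {1..n}"
  using subgroup.mem_carrier[OF assms] by (simp add: sym_group_carrier)

lemma sym_subgroup_comp:
  assumes "subgroup G (sym_group n)" "g \<in> G" "h \<in> G"
  shows "g \<circ> h \<in> G"
  using subgroup.m_closed[OF assms] by (simp add: sym_group_mult)

lemma sym_subgroup_inv:
  assumes "subgroup G (sym_group n)" "g \<in> G"
  shows "inv' g \<in> G"
  using subgroup.m_inv_closed[OF assms] subgroup.mem_carrier[OF assms] by simp

text \<open>The relevant stabilizer fixes every point below \<open>i\<close>, so by injectivity none
  of its elements can send \<open>i\<close> there.\<close>

lemma basic_orbit_ge:
  assumes "subgroup G (sym_group n)" "j \<in> basic_orbit G i"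
  shows "i \<le> j"
proof (rule ccontr)
  assume "\<not> i \<le> j"
  obtain g where g: "g \<in> stab_chain G (i - 1)" "j = g i"
    using assms(2) by (auto simp: basic_orbit_def)
  then have perm: "g permutes {1..n}"
    using sym_subgroup_permutes[OF assms(1)] by (simp add: mem_stab_chain_iff)
  have "g j = j"
  \<comment> \<open>The stabilizer condition speaks only of points from \<open>1\<close> on;
    \<open>0\<close> is fixed because it lies outside \<open>{1..n}\<close>.\<close>
  proof (cases "j = 0")
    case True
    then show ?thesis
      using permutes_not_in[OF perm] by simp
  next
    case False
    then show ?thesis
      using g(1) \<open>\<not> i \<le> j\<close> by (simp add: mem_stab_chain_iff)
  qed
  then have "i = j"
    using g(2) permutes_inj[OF perm] by (metis injD)
  with \<open>\<not> i \<le> j\<close> show False by simp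
qed

lemma basic_orbit_le:
  assumes "subgroup G (sym_group n)" "j \<in> basic_orbit G i" "i \<in> {1..n}"
  shows "j \<le> n"
proof -
  obtain g where "g \<in> G" "j = g i"
    using assms(2) by (auto simp: basic_orbit_def mem_stab_chain_iff)
  then show ?thesis
    using permutes_in_image[OF sym_subgroup_permutes[OF assms(1)]] assms(3) by auto
qed

text \<open>If \<open>j = g i = h k\<close>, then \<open>inv' h \<circ> g\<close> sends
  \<open>i\<close> to \<open>k\<close>. As \<open>i \<le> k\<close>, both factors fix all points
  below \<open>i\<close>.\<close>

lemma basic_orbit_common:
  assumes "subgroup G (sym_group n)" "i \<le> k" "j \<in> basic_orbit G i" "j \<in> basic_orbit G k"
  shows "k \<in> basic_orbit G i"
proof -
  obtain g where g: "g \<in> stab_chain G (i - 1)" "j = g i"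
    using assms(3) by (auto simp: basic_orbit_def)
  obtain h where h: "h \<in> stab_chain G (k - 1)" "j = h k"
    using assms(4) by (auto simp: basic_orbit_def)
  have "h permutes {1..n}"
    using h sym_subgroup_permutes[OF assms(1)] by (simp add: mem_stab_chain_iff)
  then have inv_h: "inv' h (h x) = x" for x
    by (simp add: permutes_inverses)
  have "(inv' h \<circ> g) m = m" if "m \<in> {1..i - 1}" for m
  proof -
    have "g m = m" "h m = m"
      using g(1) h(1) that assms(2) by (auto simp: mem_stab_chain_iff)
    then show ?thesis
      using inv_h[of m] by simp
  qed
  moreover have "inv' h \<circ> g \<in> G"
    using g h by (simp add: mem_stab_chain_iff sym_subgroup_comp[OF assms(1)]
        sym_subgroup_inv[OF assms(1)])
  moreover have "(inv' h \<circ> g) i = k"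
    using inv_h[of k] g(2) h(2) by simp
  ultimately show ?thesis
    unfolding basic_orbit_def mem_stab_chain_iff by blast
qed

text \<open>The range \<open>{1..<j}\<close> omits \<open>j\<close>, whose inequality is trivial; by
  \<open>basic_orbit_ge\<close> no larger index could occur.\<close>

definition parents :: "(nat \<Rightarrow> nat) set \<Rightarrow> nat \<Rightarrow> nat set" where
  "parents G j = {i \<in> {1..<j}. j \<in> basic_orbit G i}"

lemma finite_parents [simp]: "finite (parents G j)"
  by (simp add: parents_def)

lemma Max_parents:
  assumes "parents G j \<noteq> {}"
  shows "Max (parents G j) \<in> {1..<j}" "j \<in> basic_orbit G (Max (parents G j))"
  using Max_in[OF finite_parents assms] by (auto simp: parents_def)

lemma schreier_sims_eq_Max_parents:
  assumes G: "subgroup G (sym_group n)"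
  shows "schreier_sims n lab G =
    {x. \<forall>j\<in>{1..n}. parents G j \<noteq> {} \<longrightarrow> x $ lab j \<le> x $ lab (Max (parents G j))}"
    (is "_ = ?R")
proof
  show "schreier_sims n lab G \<subseteq> ?R"
  proof (intro subsetI CollectI ballI impI)
    fix x j assume "x \<in> schreier_sims n lab G" "j \<in> {1..n}" "parents G j \<noteq> {}"
    moreover from this have "Max (parents G j) \<in> {1..n}" "j \<in> basic_orbit G (Max (parents G j))"
      using Max_parents[of G j] by auto
    ultimately show "x $ lab j \<le> x $ lab (Max (parents G j))"
      unfolding schreier_sims_def by blast
  qed
next
  show "?R \<subseteq> schreier_sims n lab G"
  proof
    fix x assume x: "x \<in> ?R"
    \<comment> \<open>With \<open>i\<close> fixed, \<open>j\<close> is replaced by its largest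
      parent \<open>k\<close>, which again lies in the basic orbit of \<open>i\<close>; the descent
      ends at \<open>i\<close>.\<close>
    have descend: "x $ lab j \<le> x $ lab i" if "i \<in> {1..n}" "j \<in> basic_orbit G i" for i j
      using that
    proof (induction j rule: less_induct)
      case (less j)
      show ?case
      proof (cases "i = j")
        case False
        define k where "k = Max (parents G j)"
        have i: "i \<in> parents G j"
          using basic_orbit_ge[OF G less.prems(2)] less.prems False by (auto simp: parents_def)
        then have k: "k \<in> {1..<j}" "j \<in> basic_orbit G k"
          unfolding k_def using Max_parents by blast+
        have "i \<le> k"
          using i by (simp add: k_def)
        then have "k \<in> basic_orbit G i"
          using basic_orbit_common[OF G] less.prems(2) k(2) by blast
        then have "x $ lab k \<le> x $ lab i"
          using less.IH less.prems(1) k(1) by simp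
        moreover have "x $ lab j \<le> x $ lab k"
          using x i k(1) basic_orbit_le[OF G less.prems(2,1)] by (auto simp: k_def)
        ultimately show ?thesis by simp
      qed simp
    qed
    then show "x \<in> schreier_sims n lab G"
      by (simp add: schreier_sims_def)
  qed
qed

text \<open>Right multiplication by \<open>g\<close> or its inverse maps \<open>G\<close> into
  itself. The action is the identity map because group elements already are functions.\<close>

lemma orbit_sym_subgroup_eq:
  assumes G: "subgroup G (sym_group n)" and "g \<in> G"
  shows "orbit (sym_group n\<lparr>carrier := G\<rparr>) (\<lambda>g. g) (g i) =
    orbit (sym_group n\<lparr>carrier := G\<rparr>) (\<lambda>g. g) i"
proof -
  have "\<exists>h'\<in>G. h (g i) = h' i" if "h \<in> G" for h
    using sym_subgroup_comp[OF G that \<open>g \<in> G\<close>] by (intro bexI[of _ "h \<circ> g"]) auto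
  moreover have "\<exists>h'\<in>G. h i = h' (g i)" if "h \<in> G" for h
    using sym_subgroup_comp[OF G that sym_subgroup_inv[OF G \<open>g \<in> G\<close>]]
      permutes_inverses[OF sym_subgroup_permutes[OF G \<open>g \<in> G\<close>]]
    by (intro bexI[of _ "h \<circ> inv' g"]) auto
  ultimately show ?thesis
    by (fastforce simp: orbit_def)
qed

text \<open>Passing to a parent gives a smaller point of the same orbit, so sending each parentless
  point to its orbit is surjective.\<close>

lemma card_orbits_le_parentless:
  assumes G: "subgroup G (sym_group n)"
  shows "card (orbits (sym_group n\<lparr>carrier := G\<rparr>) {1..n} (\<lambda>g. g))
    \<le> card {j \<in> {1..n}. parents G j = {}}"
proof -
  let ?orb = "orbit (sym_group n\<lparr>carrier := G\<rparr>) (\<lambda>g. g)"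
  have root: "?orb j \<in> ?orb ` {j \<in> {1..n}. parents G j = {}}" if "j \<in> {1..n}" for j
    using that
  proof (induction j rule: less_induct)
    case (less j)
    show ?case
    proof (cases "parents G j = {}")
      case True
      with less.prems show ?thesis by blast
    next
      case False
      then obtain i where i: "i \<in> {1..<j}" "j \<in> basic_orbit G i"
        by (auto simp: parents_def)
      then obtain g where "g \<in> G" "j = g i"
        by (auto simp: basic_orbit_def mem_stab_chain_iff)
      then have "?orb j = ?orb i"
        using orbit_sym_subgroup_eq[OF G] by simp
      then show ?thesis
        using less.IH[of i] less.prems i(1) by simp
    qed
  qed
  have "orbits (sym_group n\<lparr>carrier := G\<rparr>) {1..n} (\<lambda>g. g)
      \<subseteq> ?orb ` {j \<in> {1..n}. parents G j = {}}"
    using root unfolding orbits_def by blast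
  then show ?thesis
    by (rule surj_card_le[rotated]) simp
qed

theorem theorem5:
  fixes n :: nat
    and lab :: "nat \<Rightarrow> 'n::finite"
    and G :: "(nat \<Rightarrow> nat) set"
  assumes "bij_betw lab {1..n} UNIV"
    and "subgroup G (sym_group n)"
  shows "polyhedron (schreier_sims n lab G) \<and>
         finite {F. F facet_of schreier_sims n lab G} \<and>
         int (card {F. F facet_of schreier_sims n lab G})
           \<le> int n - int (card (orbits (sym_group n\<lparr>carrier := G\<rparr>) {1..n} (\<lambda>g. g)))"
proof -
  define R where "R = {j \<in> {1..n}. parents G j = {}}"
  define J where "J = {j \<in> {1..n}. parents G j \<noteq> {}}"
  define h where "h j = {x :: real ^ 'n. x $ lab j \<le> x $ lab (Max (parents G j))}" for j
  have SS: "schreier_sims n lab G = \<Inter>(h ` J)"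
    unfolding schreier_sims_eq_Max_parents[OF assms(2)] by (auto simp: h_def J_def)
  have halfspace: "\<exists>a b. a \<noteq> 0 \<and> H = {x. a \<bullet> x \<le> b}" if H: "H \<in> h ` J" for H
  proof -
    obtain j where j: "j \<in> J" "H = h j"
      using H by blast
    let ?k = "Max (parents G j)"
    \<comment> \<open>This normal vector is nonzero because \<open>?k < j\<close> and
      \<open>lab\<close> is injective on \<open>{1..n}\<close>.\<close>
    let ?a = "axis (lab j) 1 - axis (lab ?k) 1 :: real ^ 'n"
    have "?k \<in> {1..<j}" "j \<in> {1..n}"
      using j(1) Max_parents(1) by (auto simp: J_def)
    then have "lab j \<noteq> lab ?k"
      using inj_onD[OF bij_betw_imp_inj_on[OF assms(1)], of j ?k] by auto
    then have "?a \<noteq> 0"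
      by (simp add: axis_eq_axis)
    moreover have "H = {x. ?a \<bullet> x \<le> 0}"
      by (simp add: j(2) h_def inner_diff_left inner_axis')
    ultimately show ?thesis by blast
  qed
  have "finite J"
    by (simp add: J_def)
  then have fin: "finite (h ` J)"
    by simp
  have "polyhedron (schreier_sims n lab G)"
    unfolding SS polyhedron_def using fin halfspace by blast
  moreover note card_facets_Inter_halfspaces_le[OF fin halfspace, folded SS]
  moreover have "card (h ` J) \<le> card J"
    by (rule card_image_le[OF \<open>finite J\<close>])
  \<comment> \<open>This turns the lower bound on parentless points into an upper bound on the
    number of halfspaces.\<close>
  moreover have "card R + card J = n"
  proof -
    have "R \<union> J = {1..n}" "R \<inter> J = {}" "finite R"
      by (auto simp: R_def J_def)
    then show ?thesis
      using card_Un_disjoint[of R J] \<open>finite J\<close> by simp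
  qed
  moreover note card_orbits_le_parentless[OF assms(2), folded R_def]
  ultimately show ?thesis
    by linarith
qed

end
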